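(* Every class of graphs with bounded $\mathrm{tree}\text{-}\mu$ is $\chi$-bounded. That is, if $\mathcal{G}$ is a class of graphs for which there is an integer $\mu$ with $\mathrm{tree}\text{-}\mu(G)\leq\mu$ for all $G\in\mathcal{G}$, then there is a function $f\colon\mathbb{N}\to\mathbb{N}$ such that every graph $G\in\mathcal{G}$ satisfies $\chi(G)\leq f(\omega(G))$.
   Context: All graphs are finite, simple, undirected, and have at least one vertex. $\mathbb{N}$ is the set of positive integers. $\chi(G)$ is the chromatic number of $G$ and $\omega(G)$ is the maximum size of a clique in $G$. A tree decomposition of a graph $G$ is a pair $\mathcal{T}=(T,\beta)$ where $T$ is a tree and $\beta$ maps each node $x$ of $T$ to a set $\beta(x)\subseteq V(G)$ (a bag) such that: (1) every vertex of $G$ belongs to some bag; (2) for every edge $uv$ of $G$, some bag contains both $u$ and $v$; (3) for every vertex $v$ of $G$, the set $\{x\in V(T)\mid v\in\beta(x)\}$ induces a connected subgraph of $T$. An induced matching in $G$ is a set $M$ of pairwise disjoint edges of $G$ such that no vertex of one edge of $M$ is adjacent in $G$ to a vertex of a different edge of $M$. An induced matching $M$ touches a set $X\subseteq V(G)$ if every edge of $M$ has at least one endpoint in $X$. For a tree decomposition $\mathcal{T}=(T,\beta)$ of $G$, $\mu(\mathcal{T})$ is the maximum, over $x\in V(T)$, of the maximum size of an induced matching in $G$ that touches $\beta(x)$. The induced matching treewidth $\mathrm{tree}\text{-}\mu(G)$ is the minimum of $\mu(\mathcal{T})$ over all tree decompositions $\mathcal{T}$ of $G$. *)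

theory Defs
  imports "Graph_Theory.Graph_Theory" "HOL-Library.Disjoint_Sets" "HOL-Library.Ramsey"
begin

text \<open>
  The locale \<open>pair_graph\<close> describes a symmetric, loop-free, finite digraph whose arcs are
  ordered pairs of vertices, that is, a finite simple undirected graph in which an edge \<open>uv\<close>
  is represented by the two arcs \<open>(u, v)\<close> and \<open>(v, u)\<close>.
\<close>

definition nonempty_graph :: "'a pair_pre_digraph \<Rightarrow> bool" where
  "nonempty_graph G \<longleftrightarrow> pair_graph G \<and> pverts G \<noteq> {}"

definition edges :: "'a pair_pre_digraph \<Rightarrow> 'a set set" where
  "edges G = {{u, v} | u v. (u, v) \<in> parcs G}"

definition proper_colouring :: "'a pair_pre_digraph \<Rightarrow> nat \<Rightarrow> ('a \<Rightarrow> nat) \<Rightarrow> bool" where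
  "proper_colouring G k c \<longleftrightarrow>
     c ` pverts G \<subseteq> {..<k} \<and> (\<forall>u v. (u, v) \<in> parcs G \<longrightarrow> c u \<noteq> c v)"

definition chromatic_number :: "'a pair_pre_digraph \<Rightarrow> nat" where
  "chromatic_number G = (LEAST k. \<exists>c. proper_colouring G k c)"

definition clique_number :: "'a pair_pre_digraph \<Rightarrow> nat" where
  "clique_number G = Max (card ` {K. K \<subseteq> pverts G \<and> clique K (edges G)})"

text \<open>
  The constant \<open>Digraph_Component.tree\<close> cannot be used here: it forbids every directed cycle,
  including the closed walks \<open>u, v, u\<close> that each edge of a symmetric digraph gives rise to.
  In a \<open>pair_graph\<close> the directed cycles with at least three arcs are exactly the
  cycles of the undirected graph. The predicate \<open>connected\<close> requires a vertex.
\<close>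

definition undirected_tree :: "'a pair_pre_digraph \<Rightarrow> bool" where
  "undirected_tree T \<longleftrightarrow>
     pair_graph T \<and> connected (with_proj T) \<and>
     \<not> (\<exists>p. pre_digraph.cycle (with_proj T) p \<and> 3 \<le> length p)"

definition tree_decomposition ::
    "'a pair_pre_digraph \<Rightarrow> 't pair_pre_digraph \<Rightarrow> ('t \<Rightarrow> 'a set) \<Rightarrow> bool" where
  "tree_decomposition G T \<beta> \<longleftrightarrow>
     undirected_tree T \<and>
     (\<forall>x \<in> pverts T. \<beta> x \<subseteq> pverts G) \<and>
     (\<forall>v \<in> pverts G. \<exists>x \<in> pverts T. v \<in> \<beta> x) \<and>
     (\<forall>u v. (u, v) \<in> parcs G \<longrightarrow> (\<exists>x \<in> pverts T. u \<in> \<beta> x \<and> v \<in> \<beta> x)) \<and>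
     (\<forall>v \<in> pverts G. connected (with_proj T \<restriction> {x \<in> pverts T. v \<in> \<beta> x}))"

definition induced_matching :: "'a pair_pre_digraph \<Rightarrow> 'a set set \<Rightarrow> bool" where
  "induced_matching G M \<longleftrightarrow>
     M \<subseteq> edges G \<and> disjoint M \<and>
     (\<forall>e \<in> M. \<forall>e' \<in> M. e \<noteq> e' \<longrightarrow> (\<forall>u \<in> e. \<forall>v \<in> e'. (u, v) \<notin> parcs G))"

definition touches :: "'a set set \<Rightarrow> 'a set \<Rightarrow> bool" where
  "touches M X \<longleftrightarrow> (\<forall>e \<in> M. e \<inter> X \<noteq> {})"

definition mu ::
    "'a pair_pre_digraph \<Rightarrow> 't pair_pre_digraph \<Rightarrow> ('t \<Rightarrow> 'a set) \<Rightarrow> nat" where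
  "mu G T \<beta> =
     Max ((\<lambda>x. Max (card ` {M. induced_matching G M \<and> touches M (\<beta> x)})) ` pverts T)"

text \<open>
  Decomposition trees are finite, so up to isomorphism their nodes may be taken to be
  natural numbers. The minimum is over a nonempty set by
  \<open>tree_decomposition_exists\<close> below.
\<close>

definition tree_mu :: "'a pair_pre_digraph \<Rightarrow> nat" where
  "tree_mu G =
     (LEAST k. \<exists>(T :: nat pair_pre_digraph) \<beta>. tree_decomposition G T \<beta> \<and> mu G T \<beta> = k)"

lemma finite_edges: "pair_graph G \<Longrightarrow> finite (edges G)"
proof -
  assume "pair_graph G"
  then interpret pair_graph G .
  have "edges G = (\<lambda>(u, v). {u, v}) ` parcs G"
    by (auto simp: edges_def)
  then show ?thesis
    using pair_finite_arcs by simp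
qed

lemma finite_induced_matchings:
  "pair_graph G \<Longrightarrow> finite {M. induced_matching G M \<and> touches M X}"
  by (rule finite_subset[of _ "Pow (edges G)"])
     (auto simp: induced_matching_def finite_edges)

lemma induced_matchings_nonempty:
  "{} \<in> {M. induced_matching G M \<and> touches M X}"
  by (simp add: induced_matching_def touches_def disjoint_def)

lemma connected_single_node:
  "connected (with_proj \<lparr>pverts = {x}, parcs = {}\<rparr>)"
  by (auto simp: connected_def mk_symmetric_def strongly_connected_def reachable_def)

lemma tree_decomposition_exists:
  assumes "pair_graph G"
  shows "tree_decomposition G \<lparr>pverts = {0 :: nat}, parcs = {}\<rparr> (\<lambda>_. pverts G)"
proof -
  interpret pair_graph G by fact
  let ?T = "\<lparr>pverts = {0 :: nat}, parcs = {}\<rparr>"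
  have T: "pair_graph ?T"
    by unfold_locales (auto simp: symmetric_def)
  have "\<not> (\<exists>p. pre_digraph.cycle (with_proj ?T) p \<and> 3 \<le> length p)"
    by (auto simp: pre_digraph.cycle_def pre_digraph.awalk_def)
  moreover have "connected (with_proj ?T \<restriction> {0})"
    using connected_single_node[of "0 :: nat"]
    by (simp add: induce_subgraph_def with_proj_def)
  moreover have "\<And>u v. (u, v) \<in> parcs G \<Longrightarrow> u \<in> pverts G \<and> v \<in> pverts G"
    using arc_fst_in_verts arc_snd_in_verts by fastforce
  ultimately show ?thesis
    using T connected_single_node
    by (auto simp: tree_decomposition_def undirected_tree_def)
qed

lemma tree_mu_attained:
  assumes "pair_graph G"
  shows "\<exists>(T :: nat pair_pre_digraph) \<beta>. tree_decomposition G T \<beta> \<and> mu G T \<beta> = tree_mu G"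
  unfolding tree_mu_def
  by (rule LeastI_ex) (use tree_decomposition_exists[OF assms] in blast)

end

theory Submission
  imports Defs
begin

text \<open>
  Fix a tree decomposition with \<open>\<mu> \<le> k\<close> and write \<open>T v\<close> for the subtree of nodes whose bags
  contain \<open>v\<close>, and \<open>T U\<close> for the union of the \<open>T u\<close> with \<open>u \<in> U\<close>. By induction on the clique number
  every neighbourhood has bounded chromatic number \<open>c\<close>.

  The set of neighbours of a subset of one bag also has bounded chromatic number: a minimal set \<open>R\<close> of
  vertices of the bag that dominates it has private neighbours, so if \<open>R\<close> were large, two
  applications of Ramsey's theorem would turn \<open>R\<close> and its private neighbours into a large
  induced matching touching the bag.

  In a connected graph, take the layers of a breadth-first search that starts from an edge. Let \<open>D\<close> be
  a layer and \<open>U\<close> the ball two levels above it, so that \<open>U\<close> and \<open>D\<close> are anticomplete. If \<open>Y\<close> is a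
  component of the graph induced by the \<open>d \<in> D\<close> with \<open>T d \<inter> T U = \<emptyset>\<close>, then a node separating
  \<open>T U\<close> from \<open>T Y\<close> has a bag that dominates \<open>Y\<close>, so these \<open>d\<close> are coloured with boundedly many
  colours. On the other \<open>d\<close> the argument is repeated. After \<open>k + 1\<close> rounds there
  are \<open>k + 1\<close> pairwise anticomplete sets \<open>U\<close> without isolated vertices whose subtrees \<open>T U\<close> pairwise
  intersect. By the Helly property some bag meets all of them, and choosing one edge in each \<open>U\<close> at
  that bag gives an induced matching of size \<open>k + 1\<close> that touches it.
\<close>

section \<open>Connected sets and colourings\<close>

text \<open>Walks must stay inside \<open>S\<close>: this is connectivity of the induced subgraph.
  The relation is a parameter because both the graph and the decomposition tree are meant. The empty
  set counts as linked.\<close>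

definition linked :: "'b rel \<Rightarrow> 'b set \<Rightarrow> bool" where
  "linked r S \<longleftrightarrow> (\<forall>x\<in>S. \<forall>y\<in>S. (x, y) \<in> (r \<inter> S \<times> S)\<^sup>*)"

text \<open>A walk inside \<open>Y\<close> from \<open>S\<close> to \<open>Y - S\<close> must use an
  arc that leaves \<open>S\<close>.\<close>

lemma linked_boundary:
  assumes "linked r Y" "S \<subseteq> Y" "S \<noteq> {}" "S \<noteq> Y"
  obtains s t where "s \<in> S" "t \<in> Y - S" "(s, t) \<in> r"
proof -
  obtain a b where ab: "a \<in> S" "b \<in> Y - S"
    using assms by blast
  then have "(a, b) \<in> (r \<inter> Y \<times> Y)\<^sup>*"
    using assms by (auto simp: linked_def)
  then have "b \<in> Y - S \<longrightarrow> (\<exists>s\<in>S. \<exists>t\<in>Y - S. (s, t) \<in> r)"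
    by induction (use ab in blast)+
  then show thesis
    using ab that by blast
qed

lemma linked_Un:
  assumes "linked r A" "linked r B" "A \<inter> B \<noteq> {}"
  shows "linked r (A \<union> B)"
proof -
  obtain z where z: "z \<in> A" "z \<in> B"
    using assms by blast
  let ?R = "r \<inter> (A \<union> B) \<times> (A \<union> B)"
  have "(r \<inter> A \<times> A)\<^sup>* \<subseteq> ?R\<^sup>*" "(r \<inter> B \<times> B)\<^sup>* \<subseteq> ?R\<^sup>*"
    by (auto intro!: rtrancl_mono)
  then have via: "(x, z) \<in> ?R\<^sup>*" "(z, x) \<in> ?R\<^sup>*" if "x \<in> A \<union> B" for x
    using assms(1,2) that z unfolding linked_def by blast+
  show ?thesis
    unfolding linked_def using via by (intro ballI) (rule rtrancl_trans)
qed

text \<open>Colouring relative to a set avoids building induced subgraphs; values of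
  \<open>c\<close> outside \<open>X\<close> are unconstrained.\<close>

definition colourable :: "'a rel \<Rightarrow> 'a set \<Rightarrow> nat \<Rightarrow> bool" where
  "colourable r X n \<longleftrightarrow>
     (\<exists>c :: 'a \<Rightarrow> nat. (\<forall>x\<in>X. c x < n) \<and> (\<forall>u\<in>X. \<forall>v\<in>X. (u, v) \<in> r \<longrightarrow> c u \<noteq> c v))"

lemma colourableI:
  fixes c :: "'a \<Rightarrow> nat"
  assumes "\<And>x. x \<in> X \<Longrightarrow> c x < n"
    and "\<And>u v. u \<in> X \<Longrightarrow> v \<in> X \<Longrightarrow> (u, v) \<in> r \<Longrightarrow> c u \<noteq> c v"
  shows "colourable r X n"
  unfolding colourable_def using assms by (intro exI[of _ c]) simp

lemma colourableE:
  assumes "colourable r X n"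
  obtains c :: "'a \<Rightarrow> nat" where "\<forall>x\<in>X. c x < n"
    "\<forall>u\<in>X. \<forall>v\<in>X. (u, v) \<in> r \<longrightarrow> c u \<noteq> c v"
  using assms unfolding colourable_def by (elim exE conjE)

lemma colourable_mono:
  assumes "colourable r X n" "Y \<subseteq> X" "n \<le> m"
  shows "colourable r Y m"
proof -
  obtain c where c: "\<forall>x\<in>X. c x < n" "\<forall>u\<in>X. \<forall>v\<in>X. (u, v) \<in> r \<longrightarrow> c u \<noteq> c v"
    using assms(1) by (rule colourableE)
  show ?thesis
  proof (rule colourableI[of _ c])
    show "c x < m" if "x \<in> Y" for x
      using c(1) that assms(2,3) by fastforce
    show "c u \<noteq> c v" if "u \<in> Y" "v \<in> Y" "(u, v) \<in> r" for u v
      using c(2) that assms(2) by blast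
  qed
qed

lemma colourable_empty [simp]: "colourable r {} n"
  by (simp add: colourable_def)

lemma colourable_Un:
  assumes "colourable r X m" "colourable r Y n"
  shows "colourable r (X \<union> Y) (m + n)"
proof -
  obtain c where c: "\<forall>x\<in>X. c x < m" "\<forall>u\<in>X. \<forall>v\<in>X. (u, v) \<in> r \<longrightarrow> c u \<noteq> c v"
    using assms(1) by (rule colourableE)
  obtain d where d: "\<forall>x\<in>Y. d x < n" "\<forall>u\<in>Y. \<forall>v\<in>Y. (u, v) \<in> r \<longrightarrow> d u \<noteq> d v"
    using assms(2) by (rule colourableE)
  show ?thesis
  proof (rule colourableI[of _ "\<lambda>x. if x \<in> X then c x else m + d x"])
    fix u v assume uv: "u \<in> X \<union> Y" "v \<in> X \<union> Y" "(u, v) \<in> r"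
    show "(if u \<in> X then c u else m + d u) \<noteq> (if v \<in> X then c v else m + d v)"
      using uv c d by (auto simp: trans_less_add1)
  next
    fix x assume "x \<in> X \<union> Y"
    then show "(if x \<in> X then c x else m + d x) < m + n"
      using c(1) d(1) by (auto simp: trans_less_add1)
  qed
qed

lemma colourable_UN:
  assumes "finite R" "\<And>x. x \<in> R \<Longrightarrow> colourable r (N x) n"
  shows "colourable r (\<Union>x\<in>R. N x) (card R * n)"
  using assms by (induction R) (auto intro: colourable_Un)

text \<open>No arc joins two classes of reachability inside \<open>X\<close>, so all classes can
  share the same \<open>n\<close> colours.\<close>

lemma colourable_components:
  assumes "sym r" and "\<And>Y. Y \<subseteq> X \<Longrightarrow> Y \<noteq> {} \<Longrightarrow> linked r Y \<Longrightarrow> colourable r Y n"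
  shows "colourable r X n"
proof -
  define R where "R = (r \<inter> X \<times> X)\<^sup>*"
  have "sym R"
    unfolding R_def using \<open>sym r\<close> by (intro sym_rtrancl) (auto simp: sym_def)
  have "trans R"
    unfolding R_def by (rule trans_rtrancl)
  \<comment> \<open>A walk inside \<open>X\<close> from \<open>x\<close> visits only the class of
    \<open>x\<close>, so the class is linked by walks within itself.\<close>
  have stay: "y \<in> X \<and> (x, y) \<in> (r \<inter> (R `` {x}) \<times> (R `` {x}))\<^sup>*"
    if "(x, y) \<in> R" "x \<in> X" for x y
    using that(1) unfolding R_def
  proof induction
    case base
    then show ?case using that by simp
  next
    case (step y z)
    then have "(y, z) \<in> r \<inter> (R `` {x}) \<times> (R `` {x})"
      unfolding R_def by (auto intro: rtrancl_into_rtrancl)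
    with step show ?case
      unfolding R_def by (auto intro: rtrancl_into_rtrancl)
  qed
  have "colourable r (R `` {x}) n" if "x \<in> X" for x
  proof (rule assms(2))
    show "R `` {x} \<subseteq> X"
      using stay that by auto
    show "R `` {x} \<noteq> {}"
      by (auto simp: R_def)
    define S where "S = (r \<inter> (R `` {x}) \<times> (R `` {x}))\<^sup>*"
    have "sym S"
      unfolding S_def using \<open>sym r\<close> by (intro sym_rtrancl) (auto simp: sym_def)
    have "(x, y) \<in> S" if "y \<in> R `` {x}" for y
      using stay[of x y] that \<open>x \<in> X\<close> by (simp add: S_def)
    then show "linked r (R `` {x})"
      unfolding linked_def S_def[symmetric]
      using symD[OF \<open>sym S\<close>] rtrancl_trans[of _ _ "r \<inter> (R `` {x}) \<times> (R `` {x})", folded S_def]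
      by blast
  qed
  then obtain c :: "'a \<Rightarrow> 'a \<Rightarrow> nat" where c: "\<And>x. x \<in> X \<Longrightarrow> (\<forall>y\<in>R `` {x}. c x y < n) \<and>
      (\<forall>u\<in>R `` {x}. \<forall>v\<in>R `` {x}. (u, v) \<in> r \<longrightarrow> c x u \<noteq> c x v)"
    unfolding colourable_def by metis
  \<comment> \<open>\<open>f\<close> picks one representative per class, so that a whole class is
    coloured by the same function \<open>c (f x)\<close>.\<close>
  define f where "f x = (SOME y. y \<in> R `` {x})" for x
  have f: "(x, f x) \<in> R" for x
    unfolding f_def using someI[of "\<lambda>y. y \<in> R `` {x}" x] by (auto simp: R_def)
  have f_eq: "f u = f v" if "(u, v) \<in> R" for u v
  proof -
    have "R `` {u} = R `` {v}"
      using that symD[OF \<open>sym R\<close>] transD[OF \<open>trans R\<close>] by blast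
    then show ?thesis
      by (simp add: f_def)
  qed
  have fX: "f x \<in> X" if "x \<in> X" for x
    using stay f that by blast
  have Rf: "(f x, x) \<in> R" for x
    using symD[OF \<open>sym R\<close> f] .
  show ?thesis
  proof (rule colourableI[of _ "\<lambda>x. c (f x) x"])
    show "c (f x) x < n" if "x \<in> X" for x
      using c[OF fX[OF that]] Rf[of x] by auto
  next
    fix u v
    assume uv: "u \<in> X" "v \<in> X" "(u, v) \<in> r"
    have "(u, v) \<in> R"
      using uv by (auto simp: R_def)
    then have "f v = f u"
      using f_eq by simp
    with c[OF fX[OF \<open>u \<in> X\<close>]] Rf[of u] Rf[of v] uv(3) show "c (f u) u \<noteq> c (f v) v"
      by auto
  qed
qed

text \<open>Two palettes alternate with the parity of the layer: adjacent vertices lie in equal or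
  consecutive layers, and equal colours force equal parity.\<close>

lemma colourable_layers:
  fixes d :: "'a \<Rightarrow> nat"
  assumes "sym r" and layer: "\<And>i. colourable r {x \<in> X. d x = i} n"
    and step: "\<And>u v. u \<in> X \<Longrightarrow> v \<in> X \<Longrightarrow> (u, v) \<in> r \<Longrightarrow> d u \<le> Suc (d v)"
  shows "colourable r X (2 * n)"
proof -
  have "\<forall>i. colourable r {x \<in> X. d x = i} n"
    using layer by (rule allI)
  then obtain c :: "nat \<Rightarrow> 'a \<Rightarrow> nat" where c: "\<forall>i. (\<forall>x\<in>{x \<in> X. d x = i}. c i x < n) \<and>
      (\<forall>u\<in>{x \<in> X. d x = i}. \<forall>v\<in>{x \<in> X. d x = i}. (u, v) \<in> r \<longrightarrow> c i u \<noteq> c i v)"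
    unfolding colourable_def by (rule choice[THEN exE])
  show ?thesis
  proof (rule colourableI[of _ "\<lambda>x. 2 * c (d x) x + d x mod 2"])
    show "2 * c (d x) x + d x mod 2 < 2 * n" if "x \<in> X" for x
      using c[rule_format, of "d x"] that by fastforce
  next
    fix u v
    assume uv: "u \<in> X" "v \<in> X" "(u, v) \<in> r"
    show "2 * c (d u) u + d u mod 2 \<noteq> 2 * c (d v) v + d v mod 2"
    proof
      assume eq: "2 * c (d u) u + d u mod 2 = 2 * c (d v) v + d v mod 2"
      have "d u \<le> Suc (d v)" "d v \<le> Suc (d u)"
        using step uv symD[OF \<open>sym r\<close> uv(3)] by simp_all
      moreover have "d u mod 2 = d v mod 2"
        using eq by presburger
      ultimately have "d u = d v"
        by presburger
      with eq c[rule_format, of "d u"] uv show False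
        by auto
    qed
  qed
qed

section \<open>Graphs represented by subtrees\<close>

definition nbhd :: "'a rel \<Rightarrow> 'a set \<Rightarrow> 'a set" where
  "nbhd r R = r `` R"

text \<open>The bound is strict, so it fails for \<open>w = 0\<close> because the empty set is a
  clique. This makes the start of the induction on \<open>w\<close> vacuous.\<close>

definition cliques_below :: "'a rel \<Rightarrow> nat \<Rightarrow> 'a set \<Rightarrow> bool" where
  "cliques_below r w X \<longleftrightarrow> (\<forall>K\<subseteq>X. (\<forall>u\<in>K. \<forall>v\<in>K. u \<noteq> v \<longrightarrow> (u, v) \<in> r) \<longrightarrow> card K < w)"

definition apart :: "'a rel \<Rightarrow> 'a set \<Rightarrow> 'a set \<Rightarrow> bool" where
  "apart r U W \<longleftrightarrow> U \<inter> W = {} \<and> U \<times> W \<inter> r = {}"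

text \<open>An abstract tree decomposition: \<open>tr v\<close> stands for the set of nodes whose
  bag contains \<open>v\<close>, and \<open>matching\<close> expresses the bound
  \<open>\<mu> \<le> k\<close>. Matching edges are ordered pairs whose first component lies in the
  bag of \<open>x\<close>.\<close>

locale subtree_representation =
  fixes adj :: "'a rel" and subtree :: "'t set \<Rightarrow> bool" and tr :: "'a \<Rightarrow> 't set"
    and V :: "'a set" and k :: nat
  assumes sym: "sym adj" and irrefl: "(v, v) \<notin> adj" and finite: "finite V"
    and subtree_Un: "subtree A \<Longrightarrow> subtree B \<Longrightarrow> A \<inter> B \<noteq> {} \<Longrightarrow> subtree (A \<union> B)"
    and helly: "finite \<A> \<Longrightarrow> \<A> \<noteq> {} \<Longrightarrow> (\<And>A. A \<in> \<A> \<Longrightarrow> subtree A) \<Longrightarrow>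
      (\<And>A B. A \<in> \<A> \<Longrightarrow> B \<in> \<A> \<Longrightarrow> A \<inter> B \<noteq> {}) \<Longrightarrow> \<Inter>\<A> \<noteq> {}"
    and subtree_tr: "v \<in> V \<Longrightarrow> subtree (tr v)"
    and tr_meet: "u \<in> V \<Longrightarrow> v \<in> V \<Longrightarrow> (u, v) \<in> adj \<Longrightarrow> tr u \<inter> tr v \<noteq> {}"
    and matching: "P \<subseteq> adj \<Longrightarrow> P \<subseteq> V \<times> V \<Longrightarrow> (\<And>a b. (a, b) \<in> P \<Longrightarrow> x \<in> tr a) \<Longrightarrow>
      (\<And>a b a' b'. (a, b) \<in> P \<Longrightarrow> (a', b') \<in> P \<Longrightarrow> (a, b) \<noteq> (a', b') \<Longrightarrow> apart adj {a, b} {a', b'}) \<Longrightarrow>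
      card P \<le> k"
begin

definition bag_bound :: "'a set \<Rightarrow> nat \<Rightarrow> bool" where
  "bag_bound W n \<longleftrightarrow> (\<forall>R Y z. R \<subseteq> W \<longrightarrow> Y \<subseteq> W \<longrightarrow> Y \<subseteq> nbhd adj R \<longrightarrow> (\<forall>p\<in>R. z \<in> tr p) \<longrightarrow>
     colourable adj Y n)"

definition trace :: "'a set \<Rightarrow> 't set" where
  "trace U = (\<Union>u\<in>U. tr u)"

lemma adj_sym: "(u, v) \<in> adj \<Longrightarrow> (v, u) \<in> adj"
  using sym by (auto dest: symD)

lemma apart_sym: "apart adj U W \<Longrightarrow> apart adj W U"
  by (auto simp: apart_def dest: adj_sym)

text \<open>A maximal nonempty subset of \<open>Y\<close> whose trace is a subtree must be
  \<open>Y\<close>: otherwise an arc leaves it, and the subtree at the end of that arc meets the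
  trace and can be added.\<close>

lemma subtree_trace:
  assumes "Y \<subseteq> V" "Y \<noteq> {}" "linked adj Y"
  shows "subtree (trace Y)"
proof -
  have "finite Y"
    using assms(1) finite by (rule finite_subset)
  obtain y where "y \<in> Y"
    using assms by blast
  define F where "F = {S \<in> Pow Y. S \<noteq> {} \<and> subtree (trace S)}"
  have "{y} \<in> F"
    using \<open>y \<in> Y\<close> assms subtree_tr by (auto simp: trace_def F_def)
  moreover have "finite F"
    using \<open>finite Y\<close> by (simp add: F_def)
  ultimately obtain S where "S \<in> F" and maximal: "\<And>S'. S' \<in> F \<Longrightarrow> S \<subseteq> S' \<Longrightarrow> S = S'"
    using finite_has_maximal[of F] by blast
  then have S: "S \<subseteq> Y" "S \<noteq> {}" "subtree (trace S)"
    by (auto simp: F_def)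
  have "S = Y"
  proof (rule ccontr)
    assume "S \<noteq> Y"
    then obtain s t where st: "s \<in> S" "t \<in> Y - S" "(s, t) \<in> adj"
      using linked_boundary[OF assms(3) S(1,2)] by blast
    then have "tr s \<inter> tr t \<noteq> {}"
      using assms S by (intro tr_meet) auto
    then have "subtree (trace S \<union> tr t)"
      using S st assms by (intro subtree_Un subtree_tr) (auto simp: trace_def)
    then have "insert t S \<in> F"
      using S st by (auto simp: trace_def F_def Un_commute)
    from maximal[OF this] show False
      using st by blast
  qed
  then show ?thesis
    using S by simp
qed

text \<open>In a tree, every subtree meeting both \<open>A\<close> and \<open>B\<close> contains the
  path between them; here a common node is derived from \<open>helly\<close> and
  \<open>subtree_Un\<close>.\<close>

lemma gate:
  assumes "subtree A" "subtree B" "A \<inter> B = {}" "P \<subseteq> V" "P \<noteq> {}"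
    and P: "\<And>p. p \<in> P \<Longrightarrow> tr p \<inter> A \<noteq> {} \<and> tr p \<inter> B \<noteq> {}"
  obtains z where "\<And>p. p \<in> P \<Longrightarrow> z \<in> tr p"
proof -
  have "finite (tr ` P)"
    using assms(4) finite by (auto intro: finite_subset)
  have meet: "tr p \<inter> tr q \<noteq> {}" if pq: "p \<in> P" "q \<in> P" for p q
  proof -
    \<comment> \<open>These sets pairwise meet. A common point misses \<open>A\<close> or
      \<open>B\<close>. If it misses \<open>A\<close>, the first and last sets put it in
      \<open>tr p\<close> and \<open>tr q\<close>; if it misses \<open>B\<close>, the middle two
      do.\<close>
    let ?F = "{A \<union> tr p, B \<union> tr q, B \<union> tr p, A \<union> tr q}"
    have "subtree X" if "X \<in> ?F" for X
      using that pq assms by (auto intro!: subtree_Un subtree_tr)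
    moreover have "X \<inter> Y \<noteq> {}" if "X \<in> ?F" "Y \<in> ?F" for X Y
      using that P[OF pq(1)] P[OF pq(2)] by blast
    ultimately have "\<Inter>?F \<noteq> {}"
      by (intro helly) auto
    then show ?thesis
      using assms(3) by blast
  qed
  have "\<Inter>(tr ` P) \<noteq> {}"
    using \<open>finite (tr ` P)\<close> assms(4,5) meet by (intro helly) (auto intro: subtree_tr)
  then show thesis
    using that by blast
qed

text \<open>A minimal subset of \<open>R\<close> dominating \<open>Y\<close> has fewer than
  \<open>m\<close> elements, and their neighbourhoods cover \<open>Y\<close>. Otherwise
  \<open>m\<close> of them would yield \<open>m2\<close> independent ones, whose private neighbours
  would in turn yield \<open>Suc k\<close> independent ones.\<close>

lemma colourable_nbhd_bag:
  assumes RV: "R \<subseteq> V" and Y: "Y \<subseteq> V" "Y \<subseteq> nbhd adj R" and bag: "\<forall>p\<in>R. z \<in> tr p"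
    and K: "cliques_below adj w (R \<union> Y)"
    and nb: "\<forall>v\<in>R. colourable adj (nbhd adj {v} \<inter> Y) c"
    and ram1: "\<forall>(S :: 'a set) E. finite S \<and> m2 \<le> card S \<longrightarrow>
      (\<exists>A\<subseteq>S. card A = w \<and> clique A E \<or> card A = Suc k \<and> indep A E)"
    and ram2: "\<forall>(S :: 'a set) E. finite S \<and> m \<le> card S \<longrightarrow>
      (\<exists>A\<subseteq>S. card A = w \<and> clique A E \<or> card A = m2 \<and> indep A E)"
  shows "colourable adj Y (m * c)"
proof -
  have "finite R"
    using RV finite by (rule finite_subset)
  define E where "E = {{u, v} | u v. (u, v) \<in> adj}"
  have E: "{u, v} \<in> E \<longleftrightarrow> (u, v) \<in> adj" for u v
    by (auto simp: E_def doubleton_eq_iff dest: adj_sym)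
  have no_clique: "\<not> (card A = w \<and> clique A E)" if "A \<subseteq> R \<union> Y" for A
    using K that unfolding cliques_below_def clique_def E by blast
  define F where "F = {S \<in> Pow R. Y \<subseteq> nbhd adj S}"
  have "finite F" "R \<in> F"
    using \<open>finite R\<close> Y by (auto simp: F_def)
  then obtain S where "S \<in> F" and minimal: "\<And>S'. S' \<in> F \<Longrightarrow> S' \<subseteq> S \<Longrightarrow> S = S'"
    using finite_has_minimal[of F] by blast
  then have S: "S \<subseteq> R" "Y \<subseteq> nbhd adj S"
    by (auto simp: F_def)
  have "finite S"
    using S(1) \<open>finite R\<close> by (rule finite_subset)
  \<comment> \<open>By minimality, some vertex of \<open>Y\<close> is not dominated without
    \<open>s\<close>; it is a private neighbour of \<open>s\<close>.\<close>
  have "\<exists>y\<in>Y. (s, y) \<in> adj \<and> (\<forall>t\<in>S. t \<noteq> s \<longrightarrow> (t, y) \<notin> adj)" if "s \<in> S" for s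
  proof (rule ccontr)
    assume "\<not> ?thesis"
    then have "Y \<subseteq> nbhd adj (S - {s})"
      using S(2) unfolding nbhd_def by blast
    then have "S - {s} \<in> F"
      using S(1) by (auto simp: F_def)
    from minimal[OF this] show False
      using that by blast
  qed
  then obtain f where f: "\<And>s. s \<in> S \<Longrightarrow> f s \<in> Y \<and> (s, f s) \<in> adj \<and> (\<forall>t\<in>S. t \<noteq> s \<longrightarrow> (t, f s) \<notin> adj)"
    by metis
  have "inj_on f S"
    using f by (metis inj_onI)
  have "card S < m"
  proof (rule ccontr)
    assume "\<not> card S < m"
    then obtain A where A: "A \<subseteq> S" "card A = w \<and> clique A E \<or> card A = m2 \<and> indep A E"
      using ram2[rule_format, of S E] \<open>finite S\<close> by auto
    moreover have "A \<subseteq> R \<union> Y"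
      using A(1) S(1) by blast
    ultimately have A: "A \<subseteq> S" "card A = m2" "indep A E"
      using no_clique by blast+
    have "finite (f ` A)" "card (f ` A) = m2" "f ` A \<subseteq> R \<union> Y"
      using A \<open>finite S\<close> \<open>inj_on f S\<close> f
      by (auto intro: finite_subset simp: card_image inj_on_subset)
    then obtain B where B: "B \<subseteq> f ` A" "card B = w \<and> clique B E \<or> card B = Suc k \<and> indep B E"
      using ram1[rule_format, of "f ` A" E] by auto
    moreover have "B \<subseteq> R \<union> Y"
      using B(1) \<open>f ` A \<subseteq> R \<union> Y\<close> by blast
    ultimately have B: "B \<subseteq> f ` A" "card B = Suc k" "indep B E"
      using no_clique by blast+
    \<comment> \<open>Both ends range over independent sets and \<open>f a\<close> is private to
      \<open>a\<close>, so these pairs form an induced matching at \<open>z\<close> with at least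
      \<open>card B\<close> edges.\<close>
    define P where "P = {(a, f a) | a. a \<in> A \<and> f a \<in> B}"
    have A': "a \<in> S" "a \<in> R" "a \<in> V" "f a \<in> V" "(a, f a) \<in> adj" if "a \<in> A" for a
      using that f[of a] A(1) S(1) RV Y by blast+
    have "card P \<le> k"
    proof (rule matching)
      show "P \<subseteq> adj" "P \<subseteq> V \<times> V"
        using A' by (auto simp: P_def)
      show "z \<in> tr a" if "(a, b) \<in> P" for a b
        using that bag A' by (auto simp: P_def)
      fix a b a' b'
      assume "(a, b) \<in> P" "(a', b') \<in> P" "(a, b) \<noteq> (a', b')"
      then have b: "b = f a" "b' = f a'" and ne: "a \<noteq> a'"
        and mem: "a \<in> A" "a' \<in> A" "f a \<in> B" "f a' \<in> B"
        by (auto simp: P_def)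
      have S': "a \<in> S" "a' \<in> S"
        using mem A' by auto
      with ne have "f a \<noteq> f a'"
        using \<open>inj_on f S\<close> by (metis inj_onD)
      then have 1: "(a, a') \<notin> adj" "(f a, f a') \<notin> adj"
        using A(3) B(3) mem ne unfolding indep_def E by blast+
      have 2: "(a', f a) \<notin> adj" "(a, f a') \<notin> adj"
        using f[OF S'(1)] f[OF S'(2)] S' ne by auto
      then have 3: "f a \<noteq> a'" "a \<noteq> f a'"
        using 1 adj_sym[OF A'(5)[OF mem(1)]] A'(5)[OF mem(2)] adj_sym[of a' a] by (auto dest: adj_sym)
      show "apart adj {a, b} {a', b'}"
        using 1 2 3 ne b \<open>f a \<noteq> f a'\<close> adj_sym[of "f a" a'] unfolding apart_def by auto
    qed
    moreover have "B \<subseteq> snd ` P"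
      using B(1) by (force simp: P_def)
    moreover have "finite P"
      by (rule finite_subset[of _ "(\<lambda>a. (a, f a)) ` A"])
        (use A(1) \<open>finite S\<close> in \<open>auto simp: P_def intro: finite_subset\<close>)
    ultimately have "card B \<le> k"
      by (meson surj_card_le order_trans)
    then show False
      using B by simp
  qed
  have "colourable adj (\<Union>s\<in>S. nbhd adj {s} \<inter> Y) (card S * c)"
    using \<open>finite S\<close> by (rule colourable_UN) (use S(1) nb in blast)
  moreover have "Y \<subseteq> (\<Union>s\<in>S. nbhd adj {s} \<inter> Y)"
    using S(2) unfolding nbhd_def by blast
  ultimately show ?thesis
    by (rule colourable_mono) (use \<open>card S < m\<close> in simp)
qed

end

section \<open>Chains of anticomplete connected sets\<close>

text \<open>\<open>j\<close> counts the sets still missing from the chain. The outer factor 2 comes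
  from layer parity, \<open>2 * c\<close> pays for the first two layers, \<open>c'\<close> for
  vertices whose subtrees avoid the ball, and the recursive term for the others. The value 1 at 0
  keeps the bound positive, as edgeless components require.\<close>

primrec chain_bound :: "nat \<Rightarrow> nat \<Rightarrow> nat \<Rightarrow> nat" where
  "chain_bound c c' 0 = 1"
| "chain_bound c c' (Suc j) = 2 * (2 * c + (c' + chain_bound c c' j))"

lemma chain_bound_pos: "1 \<le> chain_bound c c' j"
  by (induction j) auto

primrec ball :: "'a rel \<Rightarrow> 'a set \<Rightarrow> 'a set \<Rightarrow> nat \<Rightarrow> 'a set" where
  "ball r X S 0 = S"
| "ball r X S (Suc n) = ball r X S n \<union> (nbhd r (ball r X S n) \<inter> X)"

text \<open>An arc of \<open>X\<close> leaving the union of all balls would end in the next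
  ball.\<close>

lemma ball_covers:
  assumes "linked r X" "S \<subseteq> X" "S \<noteq> {}" "x \<in> X"
  shows "\<exists>n. x \<in> ball r X S n"
proof (rule ccontr)
  define B where "B = (\<Union>n. ball r X S n)"
  assume "\<not> ?thesis"
  then have "B \<noteq> X"
    using assms(4) by (auto simp: B_def)
  have "ball r X S n \<subseteq> X" for n
    using assms(2) by (induction n) auto
  then have "B \<subseteq> X"
    by (auto simp: B_def)
  have "S \<subseteq> B"
    using UN_upper[of 0 UNIV "ball r X S"] by (simp add: B_def)
  then have "B \<noteq> {}"
    using assms(3) by auto
  obtain s t where st: "s \<in> B" "t \<in> X - B" "(s, t) \<in> r"
    using assms(1) \<open>B \<subseteq> X\<close> \<open>B \<noteq> {}\<close> \<open>B \<noteq> X\<close> by (rule linked_boundary)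
  then obtain n where "s \<in> ball r X S n"
    by (auto simp: B_def)
  with st have "t \<in> ball r X S (Suc n)"
    by (auto simp: nbhd_def)
  then have "t \<in> B"
    unfolding B_def by (rule UN_I[OF UNIV_I])
  with st show False
    by simp
qed

context subtree_representation
begin

text \<open>Each vertex of \<open>S\<close> is attached through its own neighbour in
  \<open>U\<close>, so \<open>S\<close> itself may be scattered.\<close>

lemma subtree_trace_Un:
  assumes "subtree (trace U)" "U \<subseteq> V" "S \<subseteq> V" "S \<subseteq> nbhd adj U"
  shows "subtree (trace (U \<union> S))"
proof -
  have "finite S"
    using assms(3) finite by (rule finite_subset)
  then show ?thesis
    using assms(3,4)
  proof (induction S)
    case empty
    then show ?case using assms(1) by simp
  next
    case (insert s S)
    then obtain u where u: "u \<in> U" "(u, s) \<in> adj"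
      by (auto simp: nbhd_def)
    then have "tr u \<inter> tr s \<noteq> {}"
      using insert.prems assms(2) by (intro tr_meet) auto
    then have "trace (U \<union> S) \<inter> tr s \<noteq> {}"
      using u by (auto simp: trace_def)
    moreover have "subtree (trace (U \<union> S))"
      using insert by auto
    moreover have "subtree (tr s)"
      using insert.prems by (intro subtree_tr) auto
    ultimately have "subtree (trace (U \<union> S) \<union> tr s)"
      by (intro subtree_Un)
    moreover have "trace (U \<union> S) \<union> tr s = trace (U \<union> insert s S)"
      by (auto simp: trace_def)
    ultimately show ?case
      by simp
  qed
qed

text \<open>Starting from an edge leaves even the ball of radius 0 without isolated vertices, so
  every ball can join a chain.\<close>

lemma ball_edge:
  assumes "X \<subseteq> V" "a \<in> X" "b \<in> X" "(a, b) \<in> adj"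
  shows "ball adj X {a, b} n \<subseteq> X" "subtree (trace (ball adj X {a, b} n))"
    "\<forall>u\<in>ball adj X {a, b} n. \<exists>u'\<in>ball adj X {a, b} n. (u, u') \<in> adj"
proof (induction n)
  case 0
  show "ball adj X {a, b} 0 \<subseteq> X"
    using assms by simp
  have "tr a \<inter> tr b \<noteq> {}"
    using assms by (intro tr_meet) auto
  then have "subtree (tr a \<union> tr b)"
    using assms by (intro subtree_Un subtree_tr) auto
  then show "subtree (trace (ball adj X {a, b} 0))"
    by (simp add: trace_def)
  show "\<forall>u\<in>ball adj X {a, b} 0. \<exists>u'\<in>ball adj X {a, b} 0. (u, u') \<in> adj"
    using assms(4) adj_sym by auto
next
  case (Suc n)
  then show "ball adj X {a, b} (Suc n) \<subseteq> X"
    by simp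
  show "subtree (trace (ball adj X {a, b} (Suc n)))"
    using Suc assms(1) by (simp del: Un_iff, intro subtree_trace_Un) auto
  show "\<forall>u\<in>ball adj X {a, b} (Suc n). \<exists>u'\<in>ball adj X {a, b} (Suc n). (u, u') \<in> adj"
    using Suc(3) adj_sym by (auto simp: nbhd_def)
qed

text \<open>A vertex at distance two from \<open>U\<close> whose subtree avoids that of \<open>U\<close> is dominated by a
  single bag: the one at the gate between \<open>U\<close> and the component of the vertex.\<close>

lemma colourable_far:
  assumes W: "W \<subseteq> V" and U: "U \<subseteq> W" "subtree (trace U)"
    and bag: "bag_bound W n"
    and D: "D \<subseteq> W" "D \<subseteq> nbhd adj (nbhd adj U \<inter> W)" "\<And>d. d \<in> D \<Longrightarrow> tr d \<inter> trace U = {}"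
  shows "colourable adj D n"
proof (rule colourable_components[OF sym])
  fix Y assume Y: "Y \<subseteq> D" "Y \<noteq> {}" "linked adj Y"
  \<comment> \<open>Each vertex of \<open>P\<close> has a neighbour in \<open>U\<close> and one in
    \<open>Y\<close>, so its subtree meets both traces and \<open>gate\<close> yields one bag
    containing all of \<open>P\<close>.\<close>
  define P where "P = {p \<in> nbhd adj U \<inter> W. \<exists>y\<in>Y. (p, y) \<in> adj}"
  have YP: "Y \<subseteq> nbhd adj P"
    using Y(1) D(2) unfolding P_def nbhd_def by blast
  have "P \<subseteq> W"
    by (auto simp: P_def)
  have "subtree (trace Y)"
    using Y D(1) W by (intro subtree_trace) auto
  have disjoint: "trace U \<inter> trace Y = {}"
    using Y(1) D(3) by (auto simp: trace_def)
  have "P \<noteq> {}"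
    using YP Y(2) by (auto simp: nbhd_def)
  have meets: "tr p \<inter> trace U \<noteq> {} \<and> tr p \<inter> trace Y \<noteq> {}" if "p \<in> P" for p
  proof -
    note p = that
    obtain u y where uy: "u \<in> U" "(u, p) \<in> adj" "y \<in> Y" "(p, y) \<in> adj" "p \<in> W"
      using p unfolding P_def nbhd_def by blast
    then have "u \<in> V" "p \<in> V" "y \<in> V"
      using U(1) Y(1) D(1) W by blast+
    then have "tr u \<inter> tr p \<noteq> {}" "tr p \<inter> tr y \<noteq> {}"
      using uy(2,4) by (simp_all add: tr_meet)
    then show ?thesis
      using uy by (auto simp: trace_def)
  qed
  have "P \<subseteq> V"
    using \<open>P \<subseteq> W\<close> W by blast
  obtain z where z: "\<And>p. p \<in> P \<Longrightarrow> z \<in> tr p"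
    using gate[OF U(2) \<open>subtree (trace Y)\<close> disjoint \<open>P \<subseteq> V\<close> \<open>P \<noteq> {}\<close> meets] by blast
  show "colourable adj Y n"
  proof (rule bag[unfolded bag_bound_def, rule_format])
    show "P \<subseteq> W" "Y \<subseteq> nbhd adj P" "\<And>p. p \<in> P \<Longrightarrow> z \<in> tr p"
      by fact+
    show "Y \<subseteq> W"
      using Y(1) D(1) by blast
  qed
qed

text \<open>This ends the recursion by refuting chains of \<open>Suc k\<close> sets. At a common
  node \<open>z\<close> of the traces, \<open>a U\<close> is a vertex of \<open>U\<close> in the bag
  and \<open>b U\<close> is a neighbour of it inside \<open>U\<close>.\<close>

lemma no_long_chain:
  assumes fin: "finite \<U>" and ne: "\<U> \<noteq> {}"
    and U: "\<And>U. U \<in> \<U> \<Longrightarrow> U \<subseteq> V \<and> subtree (trace U) \<and> (\<forall>u\<in>U. \<exists>u'\<in>U. (u, u') \<in> adj)"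
    and apart: "\<And>U U'. U \<in> \<U> \<Longrightarrow> U' \<in> \<U> \<Longrightarrow> U \<noteq> U' \<Longrightarrow> apart adj U U'"
    and meet: "\<And>U U'. U \<in> \<U> \<Longrightarrow> U' \<in> \<U> \<Longrightarrow> trace U \<inter> trace U' \<noteq> {}"
  shows "card \<U> \<le> k"
proof -
  have "\<Inter>(trace ` \<U>) \<noteq> {}"
    using fin ne U meet by (intro helly) auto
  then obtain z where z: "\<And>U. U \<in> \<U> \<Longrightarrow> z \<in> trace U"
    by blast
  have "\<exists>a. U \<in> \<U> \<longrightarrow> a \<in> U \<and> z \<in> tr a" for U
    using z[of U] by (auto simp: trace_def)
  then obtain a where a: "\<And>U. U \<in> \<U> \<Longrightarrow> a U \<in> U \<and> z \<in> tr (a U)"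
    by metis
  have "\<exists>b. U \<in> \<U> \<longrightarrow> b \<in> U \<and> (a U, b) \<in> adj" for U
    using U[of U] a[of U] by auto
  then obtain b where b: "\<And>U. U \<in> \<U> \<Longrightarrow> b U \<in> U \<and> (a U, b U) \<in> adj"
    by metis
  note ab = a b
  have "inj_on (\<lambda>U. (a U, b U)) \<U>"
  proof (rule inj_onI)
    fix U U' assume "U \<in> \<U>" "U' \<in> \<U>" "(a U, b U) = (a U', b U')"
    then have "a U \<in> U \<inter> U'"
      using a[of U] a[of U'] by auto
    then show "U = U'"
      using apart[of U U'] \<open>U \<in> \<U>\<close> \<open>U' \<in> \<U>\<close> by (auto simp: apart_def)
  qed
  then have "card \<U> = card ((\<lambda>U. (a U, b U)) ` \<U>)"
    by (simp add: card_image)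
  also have "\<dots> \<le> k"
  proof (rule matching)
    show "(\<lambda>U. (a U, b U)) ` \<U> \<subseteq> adj"
      using ab by auto
    show "(\<lambda>U. (a U, b U)) ` \<U> \<subseteq> V \<times> V"
    proof (rule image_subsetI)
      fix U assume "U \<in> \<U>"
      then show "(a U, b U) \<in> V \<times> V"
        using a[of U] b[of U] U[of U] by auto
    qed
    show "z \<in> tr p" if "(p, q) \<in> (\<lambda>U. (a U, b U)) ` \<U>" for p q
      using that ab by auto
    fix p q p' q'
    assume *: "(p, q) \<in> (\<lambda>U. (a U, b U)) ` \<U>" "(p', q') \<in> (\<lambda>U. (a U, b U)) ` \<U>"
      "(p, q) \<noteq> (p', q')"
    then obtain U U' where UU: "U \<in> \<U>" "U' \<in> \<U>" "p = a U" "q = b U" "p' = a U'" "q' = b U'"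
      by auto
    then have "apart adj U U'"
      using *(3) by (intro apart) auto
    moreover have "{p, q} \<subseteq> U" "{p', q'} \<subseteq> U'"
      using UU ab by auto
    ultimately show "apart adj {p, q} {p', q'}"
      unfolding apart_def by blast
  qed
  finally show ?thesis .
qed

text \<open>Each layer of a breadth-first search either is dominated bag by bag or extends the chain
  \<open>\<U>\<close> by the ball two levels above it.\<close>

lemma colourable_chain:
  assumes W: "W \<subseteq> V" and nb: "\<forall>v\<in>W. colourable adj (nbhd adj {v} \<inter> W) c"
    and bag: "bag_bound W c'"
  shows "finite \<U> \<Longrightarrow> card \<U> + j = Suc k \<Longrightarrow> X \<subseteq> W \<Longrightarrow>
    (\<And>U. U \<in> \<U> \<Longrightarrow> U \<subseteq> V \<and> subtree (trace U) \<and> (\<forall>u\<in>U. \<exists>u'\<in>U. (u, u') \<in> adj)) \<Longrightarrow>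
    (\<And>U U'. U \<in> \<U> \<Longrightarrow> U' \<in> \<U> \<Longrightarrow> U \<noteq> U' \<Longrightarrow> apart adj U U') \<Longrightarrow>
    (\<And>U U'. U \<in> \<U> \<Longrightarrow> U' \<in> \<U> \<Longrightarrow> trace U \<inter> trace U' \<noteq> {}) \<Longrightarrow>
    (\<And>U. U \<in> \<U> \<Longrightarrow> apart adj U X) \<Longrightarrow>
    (\<And>U x. U \<in> \<U> \<Longrightarrow> x \<in> X \<Longrightarrow> tr x \<inter> trace U \<noteq> {}) \<Longrightarrow>
    colourable adj X (chain_bound c c' j)"
proof (induction j arbitrary: \<U> X)
  \<comment> \<open>No set is missing any more, so \<open>\<U>\<close> has \<open>Suc k\<close>
    members, which is contradictory.\<close>
  case 0
  then have "card \<U> = Suc k" "\<U> \<noteq> {}"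
    by auto
  moreover have "card \<U> \<le> k"
    using 0(1) \<open>\<U> \<noteq> {}\<close> 0(4-6) by (rule no_long_chain)
  ultimately show ?case
    by simp
next
  case (Suc j)
  note X = \<open>X \<subseteq> W\<close> and U = Suc.prems(4) and apart = Suc.prems(5) and meet = Suc.prems(6)
    and apartX = Suc.prems(7) and meetX = Suc.prems(8)
  let ?n = "2 * c + (c' + chain_bound c c' j)"
  show ?case
  proof (rule colourable_components[OF sym])
    fix Y assume Y: "Y \<subseteq> X" "Y \<noteq> {}" "linked adj Y"
    show "colourable adj Y (chain_bound c c' (Suc j))"
    proof (cases "\<exists>a\<in>Y. \<exists>b\<in>Y. (a, b) \<in> adj")
      case False
      then have "colourable adj Y 1"
        by (intro colourableI[of _ "\<lambda>_. 0"]) auto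
      then show ?thesis
        using chain_bound_pos by (rule colourable_mono[OF _ order_refl])
    next
      case True
      then obtain a b where ab: "a \<in> Y" "b \<in> Y" "(a, b) \<in> adj"
        by blast
      let ?B = "ball adj Y {a, b}"
      define d where "d x = (LEAST n. x \<in> ?B n)" for x
      have YV: "Y \<subseteq> V"
        using Y(1) X W by blast
      note B = ball_edge[OF YV ab]
      have covers: "\<exists>n. x \<in> ?B n" if "x \<in> Y" for x
        using ball_covers[OF Y(3) _ _ that, of "{a, b}"] ab by auto
      have d: "x \<in> ?B (d x)" if "x \<in> Y" for x
        unfolding d_def using covers[OF that] by (rule LeastI_ex)
      have d_le: "d x \<le> n" if "x \<in> ?B n" for x n
        unfolding d_def using that by (rule Least_le)
      have layer: "colourable adj {x \<in> Y. d x = i} ?n" for i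
      proof (cases "i \<le> 1")
        case True
        then have "i = 0 \<or> i = 1"
          by auto
        have "x \<in> ?B 1" if "x \<in> Y" "d x = i" for x
          using d[OF that(1)] that(2) \<open>i = 0 \<or> i = 1\<close> by auto
        \<comment> \<open>\<open>a\<close> and \<open>b\<close> are neighbours of each other, so the
          two neighbourhoods also cover the starting edge.\<close>
        moreover have "?B 1 \<subseteq> (nbhd adj {a} \<inter> W) \<union> (nbhd adj {b} \<inter> W)"
          using ab adj_sym Y(1) X by (auto simp: nbhd_def)
        ultimately have "{x \<in> Y. d x = i} \<subseteq> (nbhd adj {a} \<inter> W) \<union> (nbhd adj {b} \<inter> W)"
          by blast
        moreover have "colourable adj ((nbhd adj {a} \<inter> W) \<union> (nbhd adj {b} \<inter> W)) (c + c)"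
          using ab Y(1) X by (intro colourable_Un nb[rule_format]) auto
        ultimately show ?thesis
          by (elim colourable_mono) auto
      next
        case False
        define m where "m = i - 2"
        have i: "i = Suc (Suc m)"
          using False by (simp add: m_def)
        \<comment> \<open>The layer at distance \<open>m + 2\<close>. Neighbours in \<open>Y\<close>
          of the ball of radius \<open>m\<close> lie in the next ball, so no arc joins that ball to
          \<open>D\<close>.\<close>
        define D where "D = ?B (Suc (Suc m)) - ?B (Suc m)"
        define D0 where "D0 = {x \<in> D. tr x \<inter> trace (?B m) = {}}"
        define D1 where "D1 = {x \<in> D. tr x \<inter> trace (?B m) \<noteq> {}}"
        have sub: "{x \<in> Y. d x = i} \<subseteq> D0 \<union> D1"
          using d d_le i by (fastforce simp: D0_def D1_def D_def simp del: ball.simps)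
        have DY: "D \<subseteq> Y"
          using B(1)[of "Suc (Suc m)"] by (auto simp: D_def simp del: ball.simps)
        have apartD: "apart adj (?B m) D"
          using B(1)[of m] by (auto simp: D_def apart_def nbhd_def)
        have DN: "D \<subseteq> nbhd adj (nbhd adj (?B m) \<inter> W)"
          using Y(1) X unfolding D_def nbhd_def ball.simps by blast
        have "colourable adj D0 c'"
        proof (rule colourable_far[OF W _ B(2)[of m] bag])
          show "?B m \<subseteq> W"
            using B(1)[of m] Y(1) X by blast
          show "D0 \<subseteq> W" "D0 \<subseteq> nbhd adj (nbhd adj (?B m) \<inter> W)"
            using DY DN Y(1) X by (auto simp: D0_def)
          show "tr x \<inter> trace (?B m) = {}" if "x \<in> D0" for x
            using that by (simp add: D0_def)
        qed
        \<comment> \<open>The subtrees of vertices in \<open>D1\<close> meet the trace of the ball,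
          so the ball prolongs the chain and one set fewer is missing.\<close>
        moreover have "colourable adj D1 (chain_bound c c' j)"
        proof (rule Suc.IH[of "insert (?B m) \<U>"])
          have D1X: "D1 \<subseteq> X"
            using DY Y(1) by (auto simp: D1_def)
          have BX: "?B m \<subseteq> X"
            using B(1)[of m] Y(1) by blast
          have aB: "a \<in> ?B m"
            by (induction m) auto
          then have new: "?B m \<notin> \<U>"
            using apartX[of "?B m"] BX by (auto simp: apart_def)
          show "finite (insert (?B m) \<U>)"
            using Suc.prems(1) by simp
          show "card (insert (?B m) \<U>) + j = Suc k"
            using Suc.prems(1,2) new by simp
          show "D1 \<subseteq> W"
            using D1X X by blast
          show "U \<subseteq> V \<and> subtree (trace U) \<and> (\<forall>u\<in>U. \<exists>u'\<in>U. (u, u') \<in> adj)"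
            if "U \<in> insert (?B m) \<U>" for U
            using that U B[of m] YV by blast
          have apartB: "apart adj U (?B m)" if "U \<in> \<U>" for U
            using apartX[OF that] BX unfolding apart_def by blast
          then show "apart adj U U'"
            if "U \<in> insert (?B m) \<U>" "U' \<in> insert (?B m) \<U>" "U \<noteq> U'" for U U'
            using that apart apart_sym by blast
          have meetB: "trace (?B m) \<inter> trace U \<noteq> {}" if "U \<in> \<U>" for U
            using meetX[OF that, of a] aB BX by (auto simp: trace_def)
          moreover have "trace (?B m) \<inter> trace (?B m) \<noteq> {}"
            using tr_meet[OF _ _ ab(3)] aB ab YV by (auto simp: trace_def)
          ultimately show "trace U \<inter> trace U' \<noteq> {}"
            if "U \<in> insert (?B m) \<U>" "U' \<in> insert (?B m) \<U>" for U U'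
            using that meet by blast
          have "apart adj (?B m) D1"
            using apartD unfolding apart_def D1_def by blast
          moreover have "apart adj U D1" if "U \<in> \<U>" for U
            using apartX[OF that] D1X unfolding apart_def by blast
          ultimately show "apart adj U D1" if "U \<in> insert (?B m) \<U>" for U
            using that by blast
          show "tr x \<inter> trace U \<noteq> {}" if "U \<in> insert (?B m) \<U>" "x \<in> D1" for U x
            using that meetX[of U x] D1X by (auto simp: D1_def)
        qed
        ultimately have "colourable adj (D0 \<union> D1) (c' + chain_bound c c' j)"
          by (rule colourable_Un)
        then show ?thesis
          using sub by (rule colourable_mono) simp
      qed
      have "colourable adj Y (2 * ?n)"
      proof (rule colourable_layers[OF sym layer])
        fix u v assume uv: "u \<in> Y" "v \<in> Y" "(u, v) \<in> adj"
        then have "u \<in> ?B (Suc (d v))"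
          using d[OF uv(2)] adj_sym by (auto simp: nbhd_def)
        then show "d u \<le> Suc (d v)"
          by (rule d_le)
      qed
      then show ?thesis
        by simp
    qed
  qed
qed

end

section \<open>Induction on the clique number\<close>

lemma (in subtree_representation) cliques_below_nbhd:
  assumes "cliques_below adj (Suc w) X" "X \<subseteq> V" "v \<in> X"
  shows "cliques_below adj w (nbhd adj {v} \<inter> X)"
  unfolding cliques_below_def
proof (intro allI impI)
  fix L assume L: "L \<subseteq> nbhd adj {v} \<inter> X" "\<forall>u\<in>L. \<forall>v\<in>L. u \<noteq> v \<longrightarrow> (u, v) \<in> adj"
  have "\<forall>x\<in>L. (v, x) \<in> adj \<and> (x, v) \<in> adj"
    using L(1) adj_sym by (auto simp: nbhd_def)
  then have "\<forall>u\<in>insert v L. \<forall>y\<in>insert v L. u \<noteq> y \<longrightarrow> (u, y) \<in> adj" "v \<notin> L"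
    using L(2) irrefl by auto
  moreover have "insert v L \<subseteq> X"
    using L(1) assms(3) by auto
  ultimately have "card (insert v L) < Suc w"
    using assms(1) unfolding cliques_below_def by blast
  moreover have "finite L"
    using \<open>insert v L \<subseteq> X\<close> assms(2) finite by (auto intro: finite_subset)
  ultimately show "card L < w"
    using \<open>v \<notin> L\<close> by simp
qed

text \<open>The order of quantifiers matters: \<open>n\<close> is fixed before the graph, its
  representation and \<open>X\<close>.\<close>

lemma colourable_bound_exists:
  "\<exists>n. \<forall>adj subtree tr V X. subtree_representation adj (subtree :: 't set \<Rightarrow> bool) tr V k \<longrightarrow>
     X \<subseteq> V \<longrightarrow> cliques_below adj w X \<longrightarrow> colourable adj (X :: 'a set) n"
proof (induction w)
  case 0
  have "\<not> cliques_below adj 0 X" for X :: "'a set" and adj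
    by (auto simp: cliques_below_def)
  then show ?case
    by simp
next
  case (Suc w)
  then obtain c where c: "\<forall>adj subtree tr V X.
      subtree_representation adj (subtree :: 't set \<Rightarrow> bool) tr V k \<longrightarrow> X \<subseteq> V \<longrightarrow>
      cliques_below adj w X \<longrightarrow> colourable adj (X :: 'a set) c"
    by (elim exE)
  \<comment> \<open>The Ramsey numbers are chosen backwards: \<open>m2\<close> serves the second
    application, and \<open>m\<close> the first, which must leave \<open>m2\<close>
    vertices.\<close>
  obtain m2 where m2: "\<forall>(S :: 'a set) E. finite S \<and> m2 \<le> card S \<longrightarrow>
      (\<exists>A\<subseteq>S. card A = Suc w \<and> clique A E \<or> card A = Suc k \<and> indep A E)"
    using ramsey2[of "Suc w" "Suc k"] by blast
  obtain m where m: "\<forall>(S :: 'a set) E. finite S \<and> m \<le> card S \<longrightarrow>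
      (\<exists>A\<subseteq>S. card A = Suc w \<and> clique A E \<or> card A = m2 \<and> indep A E)"
    using ramsey2[of "Suc w" m2] by blast
  show ?case
  proof (intro exI allI impI)
    fix adj subtree tr V and X :: "'a set"
    assume rep: "subtree_representation adj (subtree :: 't set \<Rightarrow> bool) tr V k" and X: "X \<subseteq> V"
      and K: "cliques_below adj (Suc w) X"
    interpret subtree_representation adj subtree tr V k
      by (rule rep)
    have nb: "\<forall>v\<in>X. colourable adj (nbhd adj {v} \<inter> X) c"
    proof
      fix v assume "v \<in> X"
      then have "cliques_below adj w (nbhd adj {v} \<inter> X)"
        using K X cliques_below_nbhd by blast
      moreover have "nbhd adj {v} \<inter> X \<subseteq> V"
        using X by blast
      ultimately show "colourable adj (nbhd adj {v} \<inter> X) c"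
        using c rep by blast
    qed
    have "bag_bound X (m * c)"
      unfolding bag_bound_def
    proof (intro allI impI)
      fix R Y z
      assume *: "R \<subseteq> X" "Y \<subseteq> X" "Y \<subseteq> nbhd adj R" "\<forall>p\<in>R. z \<in> tr p"
      have "cliques_below adj (Suc w) (R \<union> Y)"
        using K *(1,2) unfolding cliques_below_def by (meson Un_least order_trans)
      moreover have "\<forall>v\<in>R. colourable adj (nbhd adj {v} \<inter> Y) c"
        using nb *(1,2) by (blast intro: colourable_mono)
      ultimately show "colourable adj Y (m * c)"
        using * X m m2 by (intro colourable_nbhd_bag[where w = "Suc w" and R = R and z = z]) auto
    qed
    \<comment> \<open>The chain starts empty, so all \<open>Suc k\<close> sets are missing.\<close>
    then show "colourable adj X (chain_bound c (m * c) (Suc k))"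
      by (intro colourable_chain[OF X nb, where \<U> = "{}"]) auto
  qed
qed

section \<open>Trees have the Helly property\<close>

text \<open>Translates reachability by \<open>rtrancl_on\<close> in the symmetric closure into walks
  that stay in the vertex set.\<close>

lemma connected_imp_linked:
  assumes "connected H" "\<And>u v. (u, v) \<in> parcs (mk_symmetric H) \<Longrightarrow> (u, v) \<in> r"
  shows "verts H \<noteq> {}" "linked r (verts H)"
proof -
  show "verts H \<noteq> {}"
    using assms(1) by (auto simp: connected_def strongly_connected_def)
  show "linked r (verts H)"
    unfolding linked_def
  proof (intro ballI)
    fix x y assume "x \<in> verts H" "y \<in> verts H"
    then have "(x, y) \<in> rtrancl_on (verts H) (parcs (mk_symmetric H))"
      using assms(1) by (auto simp: connected_def strongly_connected_def reachable_def)
    then show "(x, y) \<in> (r \<inter> verts H \<times> verts H)\<^sup>*"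
    proof (induction rule: rtrancl_on_induct)
      case (step y z)
      then have "(y, z) \<in> r \<inter> verts H \<times> verts H"
        using assms(2) by blast
      with step.IH show ?case
        by (rule rtrancl_into_rtrancl)
    qed simp
  qed
qed

lemma sym_parcs:
  assumes "pair_graph G"
  shows "sym (parcs G)"
proof -
  interpret pair_graph G by fact
  show ?thesis
    using sym_arcs by (simp add: symmetric_def)
qed

lemma connected_induce_imp_linked:
  assumes "pair_graph T" "connected (with_proj T \<restriction> S)"
  shows "S \<noteq> {}" "linked (parcs T) S"
proof -
  have "(u, v) \<in> parcs T" if "(u, v) \<in> parcs (mk_symmetric (with_proj T \<restriction> S))" for u v
    using that symD[OF sym_parcs[OF assms(1)]] by (auto simp: parcs_mk_symmetric)
  from connected_imp_linked[OF assms(2) this] show "S \<noteq> {}" "linked (parcs T) S"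
    by simp_all
qed

text \<open>The arc \<open>(p, q)\<close> and a path from \<open>q\<close> through \<open>Y\<close> and \<open>X\<close> back to \<open>p\<close> would form a cycle.\<close>

lemma tree_no_crossing:
  assumes T: "undirected_tree T" and XY: "X \<subseteq> pverts T" "Y \<subseteq> pverts T"
    and linked: "linked (parcs T) X" "linked (parcs T) Y" and "X \<inter> Y \<noteq> {}"
    and p: "p \<in> X - Y" and q: "q \<in> Y - X" and pq: "(p, q) \<in> parcs T"
  shows False
proof -
  interpret pair_graph T
    using T by (simp add: undirected_tree_def)
  \<comment> \<open>\<open>R\<close> contains neither \<open>(p, q)\<close> nor
    \<open>(q, p)\<close>, because \<open>p\<close> is outside \<open>Y\<close> and \<open>q\<close>
    outside \<open>X\<close>.\<close>
  define R where "R = parcs T \<inter> (X \<times> X \<union> Y \<times> Y)"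
  obtain s where s: "s \<in> X" "s \<in> Y"
    using \<open>X \<inter> Y \<noteq> {}\<close> by blast
  have "(parcs T \<inter> X \<times> X)\<^sup>* \<subseteq> R\<^sup>*" "(parcs T \<inter> Y \<times> Y)\<^sup>* \<subseteq> R\<^sup>*"
    by (auto simp: R_def intro!: rtrancl_mono)
  then have "(q, s) \<in> R\<^sup>*" "(s, p) \<in> R\<^sup>*"
    using linked s p q unfolding linked_def by blast+
  then have "(q, p) \<in> R\<^sup>*"
    by (rule rtrancl_trans)
  then have "\<exists>w. awalk q w p \<and> set w \<subseteq> R"
  proof induction
    case base
    then show ?case
      using q XY by (intro exI[of _ "[]"]) (auto simp: awalk_Nil_iff)
  next
    case (step y z)
    then obtain w where "awalk q w y" "set w \<subseteq> R"
      by blast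
    moreover have "awalk y [(y, z)] z"
      using step(2) by (auto simp: R_def awalk_simps dest: arc_fst_in_verts arc_snd_in_verts)
    ultimately show ?case
      using step(2) by (intro exI[of _ "w @ [(y, z)]"]) auto
  qed
  then obtain w where w: "awalk q w p" "set w \<subseteq> R"
    by blast
  define w' where "w' = awalk_to_apath w"
  have w': "apath q w' p" "set w' \<subseteq> R"
    using w apath_awalk_to_apath[OF w(1)] awalk_to_apath_subset[OF w(1)] by (auto simp: w'_def)
  \<comment> \<open>The empty path would give \<open>q = p\<close>, and a single arc would be
    \<open>(q, p)\<close>, which is not in \<open>R\<close>. Adding \<open>(p, q)\<close> thus gives
    at least three arcs, as a forbidden cycle must have.\<close>
  have len: "2 \<le> length w'"
  proof (rule ccontr)
    assume "\<not> 2 \<le> length w'"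
    then consider "w' = []" | e where "w' = [e]"
      by (cases w'; cases "tl w'") auto
    then show False
    proof cases
      case 1
      then show False
        using w'(1) p q by (auto simp: apath_Nil_iff)
    next
      case 2
      then have "e = (q, p)"
        using w'(1) by (cases e) (auto simp: apath_def awalk_simps)
      then show False
        using 2 w'(2) p q by (auto simp: R_def)
    qed
  qed
  have "cycle ((p, q) # w')"
    unfolding cycle_def
  proof (intro exI conjI)
    show "awalk p ((p, q) # w') p"
      using w'(1) pq by (auto simp: apath_def awalk_Cons_iff)
    show "distinct (tl (awalk_verts p ((p, q) # w')))"
      using w'(1) by (simp add: apath_def)
  qed simp
  with len T show False
    unfolding undirected_tree_def by force
qed

lemma tree_linked_pverts:
  assumes "undirected_tree T"
  shows "linked (parcs T) (pverts T)"
proof -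
  have "(u, v) \<in> parcs T" if "(u, v) \<in> parcs (mk_symmetric (with_proj T))" for u v
    using that assms symD[OF sym_parcs] by (auto simp: parcs_mk_symmetric undirected_tree_def)
  moreover have "connected (with_proj T)"
    using assms by (simp add: undirected_tree_def)
  ultimately show ?thesis
    using connected_imp_linked(2)[of "with_proj T" "parcs T"] by auto
qed

text \<open>If \<open>a\<close> lies in all sets but \<open>C\<close>, then the node of \<open>C\<close> nearest to \<open>a\<close> lies in all sets.\<close>

lemma tree_helly:
  assumes T: "undirected_tree T" and "finite \<A>" "\<A> \<noteq> {}"
    and "\<And>A. A \<in> \<A> \<Longrightarrow> A \<noteq> {} \<and> A \<subseteq> pverts T \<and> linked (parcs T) A"
    and "\<And>A B. A \<in> \<A> \<Longrightarrow> B \<in> \<A> \<Longrightarrow> A \<inter> B \<noteq> {}"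
  shows "\<Inter>\<A> \<noteq> {}"
  using assms(2-)
proof (induction rule: finite_ne_induct)
  case (singleton A)
  then show ?case by auto
next
  case (insert C F)
  let ?r = "parcs T"
  have "sym ?r"
    using T by (intro sym_parcs) (simp add: undirected_tree_def)
  have "\<Inter>F \<noteq> {}"
    using insert.prems by (intro insert.IH) auto
  then obtain a where a: "\<And>A. A \<in> F \<Longrightarrow> a \<in> A"
    by blast
  have C: "C \<noteq> {}" "C \<subseteq> pverts T" "linked ?r C"
    using insert.prems(1) by auto
  show ?case
  proof (cases "a \<in> C")
    case True
    then show ?thesis using a by blast
  next
    case False
    let ?D = "pverts T - C"
    \<comment> \<open>\<open>Z\<close> is the component of \<open>a\<close> in the tree with
      \<open>C\<close> removed.\<close>
    define Z where "Z = {x. (x, a) \<in> (?r \<inter> ?D \<times> ?D)\<^sup>*}"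
    have "a \<in> Z"
      by (simp add: Z_def)
    have aT: "a \<in> pverts T"
      using a insert.prems(1) insert.hyps(2) by blast
    have "x \<in> ?D" if "x \<in> Z" for x
      using that unfolding Z_def mem_Collect_eq
      by (cases rule: converse_rtranclE) (use False aT in auto)
    then have ZD: "Z \<subseteq> ?D"
      by blast
    define Q where "Q = (?r \<inter> Z \<times> Z)\<^sup>*"
    have "sym Q"
      unfolding Q_def using \<open>sym ?r\<close> by (intro sym_rtrancl) (auto simp: sym_def)
    have to_a: "(x, a) \<in> Q" if "x \<in> Z" for x
      using that unfolding Z_def Q_def mem_Collect_eq
    proof (induction rule: converse_rtrancl_induct)
      case (step y z)
      then have "(y, z) \<in> ?r \<inter> Z \<times> Z"
        by (auto simp: Z_def intro: converse_rtrancl_into_rtrancl)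
      with step.IH show ?case
        by (auto simp: Z_def intro: converse_rtrancl_into_rtrancl)
    qed simp
    have "linked ?r Z"
      unfolding linked_def Q_def[symmetric]
    proof (intro ballI)
      fix x y assume "x \<in> Z" "y \<in> Z"
      then have "(x, a) \<in> Q" "(a, y) \<in> Q"
        using to_a symD[OF \<open>sym Q\<close>] by simp_all
      then show "(x, y) \<in> Q"
        unfolding Q_def by (rule rtrancl_trans)
    qed
    \<comment> \<open>An arc leaving \<open>Z\<close> can only enter \<open>C\<close>; its end
      \<open>t\<close> is the candidate for the common node.\<close>
    obtain s t where st: "s \<in> Z" "t \<in> pverts T - Z" "(s, t) \<in> ?r"
    proof (rule linked_boundary[OF tree_linked_pverts[OF T]])
      show "Z \<subseteq> pverts T" "Z \<noteq> {}" "Z \<noteq> pverts T"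
        using ZD \<open>a \<in> Z\<close> C(1,2) by auto
    qed
    have ts: "(t, s) \<in> ?r"
      using symD[OF \<open>sym ?r\<close> st(3)] .
    have "t \<in> C"
    proof (rule ccontr)
      assume "t \<notin> C"
      then have "(t, s) \<in> ?r \<inter> ?D \<times> ?D"
        using st ts ZD by auto
      then have "t \<in> Z"
        using st(1) unfolding Z_def by (auto intro: converse_rtrancl_into_rtrancl)
      with st show False
        by simp
    qed
    have "t \<in> A" if "A \<in> F" for A
    proof (rule ccontr)
      assume "t \<notin> A"
      have A: "A \<subseteq> pverts T" "linked ?r A" "C \<inter> A \<noteq> {}"
        using that insert.prems by auto
      \<comment> \<open>\<open>A\<close> and \<open>Z\<close> share \<open>a\<close>. The linked
        sets \<open>C\<close> and \<open>A \<union> Z\<close> meet, yet the arc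
        \<open>(t, s)\<close> joins a node only in \<open>C\<close> to a node only in
        \<open>A \<union> Z\<close>.\<close>
      have "linked ?r (A \<union> Z)"
        using A(2) \<open>linked ?r Z\<close> a[OF that] \<open>a \<in> Z\<close> by (intro linked_Un) auto
      show False
        by (rule tree_no_crossing[OF T C(2) _ C(3) \<open>linked ?r (A \<union> Z)\<close> _ _ _ ts])
          (use A ZD \<open>t \<in> C\<close> \<open>t \<notin> A\<close> st in auto)
    qed
    then show ?thesis
      using \<open>t \<in> C\<close> by blast
  qed
qed

section \<open>Tree decompositions as subtree representations\<close>

text \<open>Distinct pairs are apart, hence disjoint as edges, so forgetting the orientation is
  injective on \<open>P\<close>.\<close>

lemma card_matching_le_mu:
  assumes G: "pair_graph G" and T: "pair_graph T" and x: "x \<in> pverts T"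
    and P: "P \<subseteq> parcs G" "\<And>a b. (a, b) \<in> P \<Longrightarrow> a \<in> \<beta> x"
    and apart: "\<And>a b a' b'. (a, b) \<in> P \<Longrightarrow> (a', b') \<in> P \<Longrightarrow> (a, b) \<noteq> (a', b') \<Longrightarrow>
      apart (parcs G) {a, b} {a', b'}"
  shows "card P \<le> mu G T \<beta>"
proof -
  define e :: "'a \<times> 'a \<Rightarrow> 'a set" where "e p = {fst p, snd p}" for p
  have apart_e: "apart (parcs G) (e p) (e p')" if "p \<in> P" "p' \<in> P" "p \<noteq> p'" for p p'
    using apart[of "fst p" "snd p" "fst p'" "snd p'"] that by (simp add: e_def prod_eq_iff)
  have "inj_on e P"
    using apart_e unfolding inj_on_def apart_def e_def by blast
  then have "card P = card (e ` P)"
    by (simp add: card_image)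
  also have "\<dots> \<le> Max (card ` {M. induced_matching G M \<and> touches M (\<beta> x)})"
  proof (intro Max_ge imageI CollectI conjI)
    show "finite (card ` {M. induced_matching G M \<and> touches M (\<beta> x)})"
      using finite_induced_matchings[OF G] by (rule finite_imageI)
    have "e ` P \<subseteq> edges G"
      using P(1) by (force simp: edges_def e_def)
    moreover have "disjoint (e ` P)"
      using apart_e by (fastforce simp: disjoint_def apart_def)
    moreover have "\<forall>E\<in>e ` P. \<forall>E'\<in>e ` P. E \<noteq> E' \<longrightarrow> (\<forall>u\<in>E. \<forall>v\<in>E'. (u, v) \<notin> parcs G)"
      using apart_e unfolding apart_def by blast
    ultimately show "induced_matching G (e ` P)"
      by (simp add: induced_matching_def)
    show "touches (e ` P) (\<beta> x)"
      using P(2) by (force simp: touches_def e_def)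
  qed
  also have "\<dots> \<le> mu G T \<beta>"
  proof -
    interpret T: pair_graph T by fact
    show ?thesis
      unfolding mu_def using x T.pair_finite_verts by (intro Max_ge) auto
  qed
  finally show ?thesis .
qed

lemma tree_decomposition_representation:
  assumes G: "pair_graph G" and td: "tree_decomposition G T \<beta>" and "mu G T \<beta> \<le> k"
  shows "subtree_representation (parcs G) (\<lambda>S. S \<noteq> {} \<and> S \<subseteq> pverts T \<and> linked (parcs T) S)
    (\<lambda>v. {x \<in> pverts T. v \<in> \<beta> x}) (pverts G) k"
proof -
  interpret G: pair_graph G by fact
  have T: "undirected_tree T" "pair_graph T"
    using td by (auto simp: tree_decomposition_def undirected_tree_def)
  show ?thesis
  proof
    show "sym (parcs G)"
      using G by (rule sym_parcs)
    show "(v, v) \<notin> parcs G" for v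
      using G.no_loops by fastforce
    show "finite (pverts G)"
      by (rule G.pair_finite_verts)
    show "A \<union> B \<noteq> {} \<and> A \<union> B \<subseteq> pverts T \<and> linked (parcs T) (A \<union> B)"
      if "A \<noteq> {} \<and> A \<subseteq> pverts T \<and> linked (parcs T) A"
        "B \<noteq> {} \<and> B \<subseteq> pverts T \<and> linked (parcs T) B" "A \<inter> B \<noteq> {}" for A B
      using that by (auto intro: linked_Un)
    show "\<Inter>\<A> \<noteq> {}" if "finite \<A>" "\<A> \<noteq> {}"
      "\<And>A. A \<in> \<A> \<Longrightarrow> A \<noteq> {} \<and> A \<subseteq> pverts T \<and> linked (parcs T) A"
      "\<And>A B. A \<in> \<A> \<Longrightarrow> B \<in> \<A> \<Longrightarrow> A \<inter> B \<noteq> {}" for \<A>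
      using tree_helly[OF T(1) that] .
    show "{x \<in> pverts T. v \<in> \<beta> x} \<noteq> {} \<and> {x \<in> pverts T. v \<in> \<beta> x} \<subseteq> pverts T \<and>
        linked (parcs T) {x \<in> pverts T. v \<in> \<beta> x}" if "v \<in> pverts G" for v
    proof -
      have "connected (with_proj T \<restriction> {x \<in> pverts T. v \<in> \<beta> x})"
        using td that by (simp add: tree_decomposition_def)
      from connected_induce_imp_linked[OF T(2) this] show ?thesis
        by blast
    qed
    show "{x \<in> pverts T. u \<in> \<beta> x} \<inter> {x \<in> pverts T. v \<in> \<beta> x} \<noteq> {}"
      if "(u, v) \<in> parcs G" for u v
      using td that unfolding tree_decomposition_def by blast
    show "card P \<le> k"
      if P: "P \<subseteq> parcs G" "\<And>a b. (a, b) \<in> P \<Longrightarrow> x \<in> {x \<in> pverts T. a \<in> \<beta> x}"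
        "\<And>a b a' b'. (a, b) \<in> P \<Longrightarrow> (a', b') \<in> P \<Longrightarrow> (a, b) \<noteq> (a', b') \<Longrightarrow>
          apart (parcs G) {a, b} {a', b'}" for P x
    \<comment> \<open>\<open>x\<close> is arbitrary and known to be a node of \<open>T\<close> only
      through an element of \<open>P\<close>.\<close>
    proof (cases "P = {}")
      case False
      then have "x \<in> pverts T"
        using P(2) by auto
      then have "card P \<le> mu G T \<beta>"
        using P by (intro card_matching_le_mu[OF G T(2)]) auto
      then show ?thesis
        using \<open>mu G T \<beta> \<le> k\<close> by simp
    qed simp
  qed
qed

section \<open>Clique number, chromatic number and the final bound\<close>

lemma card_clique_le_clique_number:
  assumes "pair_graph G" "K \<subseteq> pverts G" "\<And>u v. u \<in> K \<Longrightarrow> v \<in> K \<Longrightarrow> u \<noteq> v \<Longrightarrow> (u, v) \<in> parcs G"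
  shows "card K \<le> clique_number G"
proof -
  interpret pair_graph G by fact
  have "finite {K. K \<subseteq> pverts G \<and> clique K (edges G)}"
    by (rule finite_subset[of _ "Pow (pverts G)"]) (auto simp: pair_finite_verts)
  moreover have "clique K (edges G)"
    using assms(3) unfolding clique_def edges_def by blast
  ultimately show ?thesis
    unfolding clique_number_def using assms(2) by (intro Max_ge) auto
qed

lemma chromatic_number_le:
  assumes "pair_graph G" "colourable (parcs G) (pverts G) n"
  shows "chromatic_number G \<le> n"
proof -
  interpret pair_graph G by fact
  obtain c where c: "\<forall>x\<in>pverts G. c x < n"
    "\<forall>u\<in>pverts G. \<forall>v\<in>pverts G. (u, v) \<in> parcs G \<longrightarrow> c u \<noteq> c v"
    using assms(2) by (rule colourableE)
  have "c u \<noteq> c v" if "(u, v) \<in> parcs G" for u v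
  proof -
    have "u \<in> pverts G" "v \<in> pverts G"
      using arc_fst_in_verts[OF that] arc_snd_in_verts[OF that] by simp_all
    then show ?thesis
      using c(2) that by blast
  qed
  then have "proper_colouring G n c"
    using c(1) by (auto simp: proper_colouring_def)
  then show ?thesis
    unfolding chromatic_number_def by (intro Least_le) blast
qed

theorem theorem1p3:
  fixes \<G> :: "'a pair_pre_digraph set"
  assumes graphs: "\<forall>G \<in> \<G>. nonempty_graph G"
    and bounded: "\<exists>\<mu> :: int. \<forall>G \<in> \<G>. int (tree_mu G) \<le> \<mu>"
  shows "\<exists>f :: nat \<Rightarrow> nat. (\<forall>n \<ge> 1. f n \<ge> 1) \<and>
           (\<forall>G \<in> \<G>. chromatic_number G \<le> f (clique_number G))"
proof -
  obtain \<mu> :: int where \<mu>: "\<forall>G \<in> \<G>. int (tree_mu G) \<le> \<mu>"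
    using bounded by blast
  \<comment> \<open>Truncation at 0 is harmless, since \<open>tree_mu G\<close> is a natural number:
    any member of the class forces \<open>\<mu>\<close> to be nonnegative.\<close>
  define k where "k = nat \<mu>"
  have "\<forall>w. \<exists>n. \<forall>adj subtree tr V X.
      subtree_representation adj (subtree :: nat set \<Rightarrow> bool) tr V k \<longrightarrow> X \<subseteq> V \<longrightarrow>
      cliques_below adj w X \<longrightarrow> colourable adj (X :: 'a set) n"
    by (intro allI colourable_bound_exists)
  then obtain N where N: "\<forall>w adj subtree tr V X.
      subtree_representation adj (subtree :: nat set \<Rightarrow> bool) tr V k \<longrightarrow> X \<subseteq> V \<longrightarrow>
      cliques_below adj w X \<longrightarrow> colourable adj (X :: 'a set) (N w)"
    by (rule choice[THEN exE])
  show ?thesis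
  \<comment> \<open>\<open>Suc n\<close> matches the strict bound in \<open>cliques_below\<close>,
    and \<open>max 1\<close> keeps the values positive.\<close>
  proof (intro exI[of _ "\<lambda>n. max 1 (N (Suc n))"] conjI ballI allI impI)
    fix G assume "G \<in> \<G>"
    then have G: "pair_graph G"
      using graphs by (simp add: nonempty_graph_def)
    obtain T :: "nat pair_pre_digraph" and \<beta> where T: "tree_decomposition G T \<beta>" "mu G T \<beta> = tree_mu G"
      using tree_mu_attained[OF G] by blast
    have "mu G T \<beta> \<le> k"
      using \<mu> \<open>G \<in> \<G>\<close> T(2) unfolding k_def by fastforce
    have rep: "subtree_representation (parcs G) (\<lambda>S. S \<noteq> {} \<and> S \<subseteq> pverts T \<and> linked (parcs T) S)
        (\<lambda>v. {x \<in> pverts T. v \<in> \<beta> x}) (pverts G) k"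
      using G T(1) \<open>mu G T \<beta> \<le> k\<close> by (rule tree_decomposition_representation)
    have "cliques_below (parcs G) (Suc (clique_number G)) (pverts G)"
      using card_clique_le_clique_number[OF G] by (simp add: cliques_below_def less_Suc_eq_le)
    then have "colourable (parcs G) (pverts G) (N (Suc (clique_number G)))"
      using N[rule_format, OF rep order_refl] by blast
    then show "chromatic_number G \<le> max 1 (N (Suc (clique_number G)))"
      using chromatic_number_le[OF G] by (simp add: le_max_iff_disj)
  qed simp
qed

end
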